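(* Let $0<q\le\infty$ and $0<p<t<r\le\infty$. Then there exists a linear mapping $\Phi:\ell^r\to M_{p,q}^{t,r}(\mathbb R^n)$ such that $$C^{-1}\|a\|_{\ell^r}\le\|\Phi(a)\|_{M_{p,q}^{t,r}(\mathbb R^n)}\le C\|a\|_{\ell^r}$$ for all $a\in\ell^r$, for some constant $C>0$ independent of $a$.
   Context: Here $t<\infty$ and $\ell^r=\ell^r(\mathbb N)$. Lorentz norm: with $d_f(s)=|\{x:|f(x)|>s\}|$ and $f^*(u)=\inf\{s>0:d_f(s)\le u\}$, $\|f\|_{L^{p,q}}=\left(\int_0^\infty(u^{1/p}f^*(u))^q\frac{du}{u}\right)^{1/q}$ for $q<\infty$ and $\|f\|_{L^{p,\infty}}=\sup_{u>0}u^{1/p}f^*(u)$; $\|f\|_{L^{p,q}(Q)}=\|f\chi_Q\|_{L^{p,q}}$. Dyadic cubes: $Q_{j,m}=\prod_{i=1}^n[2^{-j}m_i,2^{-j}(m_i+1))$, $j\in\mathbb Z$, $m\in\mathbb Z^n$; $\mathcal D$ is the set of all of them. $M_{p,q}^{t,r}(\mathbb R^n)$ is the set of measurable $f$ with $\|f\|_{M_{p,q}^{t,r}(\mathbb R^n)}=\left(\sum_{Q\in\mathcal D}|Q|^{r/t-r/p}\|f\|_{L^{p,q}(Q)}^r\right)^{1/r}<\infty$ (supremum over $Q\in\mathcal D$ of $|Q|^{1/t-1/p}\|f\|_{L^{p,q}(Q)}$ if $r=\infty$). *)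

theory Defs
  imports "HOL-Analysis.Analysis"
begin

text \<open>Real powers on \<open>[0, \<infinity>]\<close>, meant for exponents \<open>a > 0\<close> only, where
  \<open>0 powr a = 0\<close> and \<open>\<infinity> powr a = \<infinity>\<close>.\<close>

definition epowr :: "ennreal \<Rightarrow> real \<Rightarrow> ennreal" where
  "epowr x a = (if x = \<infinity> then \<infinity> else ennreal (enn2real x powr a))"

definition distr_fun :: "(real ^ 'n \<Rightarrow> 'k::real_normed_vector) \<Rightarrow> real \<Rightarrow> ennreal" where
  "distr_fun f s = emeasure lebesgue {x. norm (f x) > s}"

text \<open>The infimum is taken in \<open>[0, \<infinity>]\<close>, so it is \<open>\<infinity>\<close> if no \<open>s\<close> qualifies.\<close>

definition decr_rearr :: "(real ^ 'n \<Rightarrow> 'k::real_normed_vector) \<Rightarrow> real \<Rightarrow> ennreal" where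
  "decr_rearr f u = Inf {ennreal s |s. s > 0 \<and> distr_fun f s \<le> ennreal u}"

definition lorentz_norm :: "real \<Rightarrow> ennreal \<Rightarrow> (real ^ 'n \<Rightarrow> 'k::real_normed_vector) \<Rightarrow> ennreal" where
  "lorentz_norm p q f =
     (if q = \<infinity> then (SUP u\<in>{0<..}. ennreal (u powr (1 / p)) * decr_rearr f u)
      else epowr
        (\<integral>\<^sup>+u\<in>{0<..}. epowr (ennreal (u powr (1 / p)) * decr_rearr f u) (enn2real q)
           * ennreal (1 / u) \<partial>lborel)
        (1 / enn2real q))"

definition lorentz_norm_on ::
    "real \<Rightarrow> ennreal \<Rightarrow> (real ^ 'n) set \<Rightarrow> (real ^ 'n \<Rightarrow> 'k::real_normed_vector) \<Rightarrow> ennreal" where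
  "lorentz_norm_on p q Q f = lorentz_norm p q (\<lambda>x. indicat_real Q x *\<^sub>R f x)"

definition dyadic_cube :: "int \<Rightarrow> int ^ 'n \<Rightarrow> (real ^ 'n) set" where
  "dyadic_cube j m = {x. \<forall>i. 2 powi (- j) * of_int (m $ i) \<le> x $ i
                           \<and> x $ i < 2 powi (- j) * (of_int (m $ i) + 1)}"

definition dyadic_cubes :: "(real ^ 'n) set set" where
  "dyadic_cubes = {dyadic_cube j m |j m. True}"

definition bm_norm ::
    "real \<Rightarrow> ennreal \<Rightarrow> real \<Rightarrow> ennreal \<Rightarrow> (real ^ 'n \<Rightarrow> 'k::real_normed_vector) \<Rightarrow> ennreal" where
  "bm_norm p q t r f =
     (if r = \<infinity> then
        (SUP Q\<in>dyadic_cubes.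
           ennreal (measure lebesgue Q powr (1 / t - 1 / p)) * lorentz_norm_on p q Q f)
      else epowr
        (\<Sum>\<^sub>\<infinity>Q\<in>dyadic_cubes.
           ennreal (measure lebesgue Q powr (enn2real r / t - enn2real r / p))
           * epowr (lorentz_norm_on p q Q f) (enn2real r))
        (1 / enn2real r))"

definition bm_space ::
    "real \<Rightarrow> ennreal \<Rightarrow> real \<Rightarrow> ennreal \<Rightarrow> (real ^ 'n \<Rightarrow> 'k::real_normed_vector) set" where
  "bm_space p q t r = {f \<in> borel_measurable lebesgue. bm_norm p q t r f < \<infinity>}"

definition ell_norm :: "ennreal \<Rightarrow> (nat \<Rightarrow> 'k::real_normed_vector) \<Rightarrow> ennreal" where
  "ell_norm r a =
     (if r = \<infinity> then (SUP k. ennreal (norm (a k)))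
      else epowr (\<Sum>k. ennreal (norm (a k) powr enn2real r)) (1 / enn2real r))"

definition ell :: "ennreal \<Rightarrow> (nat \<Rightarrow> 'k::real_normed_vector) set" where
  "ell r = {a. ell_norm r a < \<infinity>}"

text \<open>Linearity, over the scalar field \<open>'k\<close>, of a map between spaces of \<open>'k\<close>-valued functions;
  the domain is a subset of a function type, so the library's type-based \<open>linear\<close> does not apply.\<close>

definition linear_map_on :: "('a \<Rightarrow> 'k::field) set \<Rightarrow> (('a \<Rightarrow> 'k) \<Rightarrow> ('b \<Rightarrow> 'k)) \<Rightarrow> bool" where
  "linear_map_on S \<Phi> \<longleftrightarrow>
     (\<forall>a\<in>S. \<forall>b\<in>S. \<Phi> (\<lambda>k. a k + b k) = (\<lambda>x. \<Phi> a x + \<Phi> b x)) \<and>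
     (\<forall>c. \<forall>a\<in>S. \<Phi> (\<lambda>k. c * a k) = (\<lambda>x. c * \<Phi> a x))"

end

theory Submission
  imports Defs "HOL-Real_Asymp.Real_Asymp"
begin

text \<open>
  The map places \<open>a k\<close> on the unit dyadic cube with corner \<open>(2 ^ k, \<dots>, 2 ^ k)\<close>. Testing the norm on
  these cubes alone gives the lower bound. For the upper bound, a dyadic cube of side \<open>2 ^ N\<close> meets
  at most \<open>N + 1\<close> of them, so the Lorentz norm on it is at most a constant times
  \<open>(N + 1) powr (1 / p)\<close> times the largest \<open>norm (a k)\<close> seen there; this growth is absorbed by the
  weight, because \<open>p < t\<close>. A cube of side \<open>2 ^ (- j)\<close> with \<open>j \<ge> 0\<close> sees one value only, and
  \<open>t < r\<close> makes the sum over \<open>j\<close> converge. Within one level the \<open>r\<close>-th powers of the largest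
  values add up because \<open>norm (a k) powr r\<close> is controlled by the integral of the \<open>r\<close>-th power of
  the function over the cube, and cubes of one level are disjoint.
\<close>

subsection \<open>Lorentz norms of bounded functions\<close>

lemma epowr_ennreal: "0 \<le> x \<Longrightarrow> epowr (ennreal x) a = ennreal (x powr a)"
  by (simp add: epowr_def)

lemma epowr_mono:
  assumes "x \<le> y" "0 < a"
  shows "epowr x a \<le> epowr y a"
proof (cases "y = \<infinity>")
  case False
  then have "enn2real x powr a \<le> enn2real y powr a"
    using assms by (intro powr_mono2) (auto intro!: enn2real_mono simp: less_top)
  then show ?thesis
    using False assms(1) by (auto simp: epowr_def top_unique intro!: ennreal_leI)
qed (simp add: epowr_def)

lemma epowr_cmult:
  assumes "0 < c"
  shows "epowr (ennreal c * x) a = ennreal (c powr a) * epowr x a"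
proof (cases "x = \<infinity>")
  case True
  then show ?thesis using assms by (simp add: epowr_def ennreal_mult_top)
next
  case False
  then have "ennreal c * x \<noteq> \<infinity>" by (simp add: ennreal_mult_eq_top_iff)
  then show ?thesis
    using False assms by (simp add: epowr_def enn2real_mult powr_mult ennreal_mult')
qed

text \<open>Every level \<open>A + e\<close> with \<open>e > 0\<close> is admissible, because its
  superlevel set is empty. The level \<open>A\<close> itself may be 0, which the infimum over
  \<open>s > 0\<close> excludes; hence the detour through \<open>e\<close>.\<close>

lemma decr_rearr_le:
  assumes "\<And>x. norm (f x) \<le> A"
  shows "decr_rearr f u \<le> ennreal A"
proof (rule ennreal_le_epsilon)
  fix e :: real assume "0 < e"
  have "0 \<le> A" using assms[of undefined] norm_ge_zero order_trans by blast
  have "\<not> A + e < norm (f x)" for x using assms[of x] \<open>0 < e\<close> by linarith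
  then have "distr_fun f (A + e) = 0" by (simp add: distr_fun_def)
  then have "decr_rearr f u \<le> ennreal (A + e)"
    unfolding decr_rearr_def using \<open>0 < e\<close> \<open>0 \<le> A\<close>
    by (intro Inf_lower) (auto intro!: exI[of _ "A + e"])
  then show "decr_rearr f u \<le> ennreal A + ennreal e"
    using \<open>0 < e\<close> \<open>0 \<le> A\<close> by simp
qed

text \<open>Every superlevel set at a positive level lies in \<open>S\<close>, so all levels
  \<open>e > 0\<close> are admissible and the infimum is 0.\<close>

lemma decr_rearr_eq_0:
  assumes "{x. f x \<noteq> 0} \<subseteq> S" "S \<in> sets lebesgue" "emeasure lebesgue S \<le> ennreal u"
  shows "decr_rearr f u = 0"
proof -
  have "decr_rearr f u \<le> 0 + ennreal e" if "0 < e" for e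
  proof -
    have "distr_fun f e \<le> emeasure lebesgue S"
      unfolding distr_fun_def using assms that by (intro emeasure_mono) auto
    then have "distr_fun f e \<le> ennreal u" using assms(3) by (rule order_trans)
    with that have "ennreal e \<in> {ennreal s |s. 0 < s \<and> distr_fun f s \<le> ennreal u}" by blast
    then show ?thesis
      unfolding decr_rearr_def add_0 by (rule Inf_lower)
  qed
  then have "decr_rearr f u \<le> 0" by (rule ennreal_le_epsilon)
  then show ?thesis by simp
qed

text \<open>No level \<open>s < A\<close> is admissible: its superlevel set is all of
  \<open>S\<close>, whose measure \<open>V\<close> exceeds \<open>u\<close>.\<close>

lemma decr_rearr_ge:
  assumes "\<And>x. x \<in> S \<Longrightarrow> norm (f x) = A" "\<And>x. x \<notin> S \<Longrightarrow> f x = 0"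
    and "emeasure lebesgue S = ennreal V" "0 \<le> u" "u < V"
  shows "ennreal A \<le> decr_rearr f u"
  unfolding decr_rearr_def
proof (rule Inf_greatest, clarify)
  fix s :: real assume s: "0 < s" "distr_fun f s \<le> ennreal u"
  show "ennreal A \<le> ennreal s"
  proof (rule ccontr)
    assume "\<not> ?thesis"
    then have "s < A" using s(1) by (auto simp: ennreal_leI not_le)
    then have "{x. s < norm (f x)} = S" using assms(1,2) s(1) by (force simp: not_less)
    then have "ennreal V \<le> ennreal u" using s(2) assms(3) by (simp add: distr_fun_def)
    then show False using assms(4,5) by (auto simp: ennreal_le_iff)
  qed
qed

section \<open>Lorentz norms of multiples of indicators\<close>

lemma nn_integral_powr_from_0:
  assumes "0 < b" "0 \<le> V"
  shows "(\<integral>\<^sup>+u\<in>{0<..<V}. ennreal (u powr (b - 1)) \<partial>lborel) = ennreal (V powr b / b)"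
proof -
  have "((\<lambda>u. u powr (b - 1)) has_integral (V powr b / b)) {0..V}"
    using has_integral_powr_from_0[of "b - 1" V] assms by simp
  then have "(\<integral>\<^sup>+u\<in>{0..V}. ennreal (u powr (b - 1)) \<partial>lborel) = ennreal (V powr b / b)"
    by (intro nn_integral_has_integral_lebesgue') auto
  moreover have "AE u in lborel. u \<noteq> 0 \<and> u \<noteq> V"
    using AE_lborel_singleton[of 0] AE_lborel_singleton[of V] by eventually_elim simp
  then have "(\<integral>\<^sup>+u\<in>{0..V}. ennreal (u powr (b - 1)) \<partial>lborel)
      = (\<integral>\<^sup>+u\<in>{0<..<V}. ennreal (u powr (b - 1)) \<partial>lborel)"
    by - (rule nn_integral_cong_AE, erule eventually_mono, auto simp: indicator_def)
  ultimately show ?thesis by simp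
qed

text \<open>This is the Lorentz norm of the indicator of a set of measure 1. For a multiple
  \<open>A\<close> of the indicator of a set of measure \<open>V\<close> the norm is this constant
  times \<open>A * V powr (1 / p)\<close>; the two bounds below are modelled on that value.\<close>

definition lorentz_const :: "real \<Rightarrow> ennreal \<Rightarrow> real" where
  "lorentz_const p q = (if q = \<infinity> then 1 else (p / enn2real q) powr (1 / enn2real q))"

lemma lorentz_const_pos: "0 < p \<Longrightarrow> 0 < q \<Longrightarrow> 0 < lorentz_const p q"
  by (auto simp: lorentz_const_def enn2real_eq_0_iff)

text \<open>On u > 0 the integrand is \<open>A powr q * u powr (q / p - 1)\<close>, so the integral
  is \<open>p / q * A powr q * V powr (q / p)\<close>. The parameter \<open>q\<close> is real
  here.\<close>

lemma lorentz_integral: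
  assumes "0 < p" "0 < q" "0 \<le> A" "0 \<le> V"
  shows "epowr (\<integral>\<^sup>+u\<in>{0<..<V}. epowr (ennreal (u powr (1 / p)) * ennreal A) q
           * ennreal (1 / u) \<partial>lborel) (1 / q)
         = ennreal ((p / q) powr (1 / q) * A * V powr (1 / p))"
proof -
  have "epowr (ennreal (u powr (1 / p)) * ennreal A) q * ennreal (1 / u)
      = ennreal (A powr q) * ennreal (u powr (q / p - 1))" if "0 < u" for u
    using that assms
    by (simp add: ennreal_mult[symmetric] epowr_ennreal powr_mult powr_powr powr_diff mult.commute)
  then have "(\<integral>\<^sup>+u\<in>{0<..<V}. epowr (ennreal (u powr (1 / p)) * ennreal A) q
           * ennreal (1 / u) \<partial>lborel)
      = (\<integral>\<^sup>+u. ennreal (A powr q) * (ennreal (u powr (q / p - 1)) * indicator {0<..<V} u) \<partial>lborel)"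
    by (intro nn_integral_cong) (auto simp: indicator_def)
  also have "\<dots> = ennreal (A powr q) * ennreal (V powr (q / p) / (q / p))"
    using assms by (subst nn_integral_cmult) (simp_all add: nn_integral_powr_from_0)
  also have "\<dots> = ennreal (p / q * A powr q * V powr (q / p))"
    using assms by (simp add: ennreal_mult[symmetric] mult_ac)
  finally have "epowr (\<integral>\<^sup>+u\<in>{0<..<V}. epowr (ennreal (u powr (1 / p)) * ennreal A) q
           * ennreal (1 / u) \<partial>lborel) (1 / q)
      = ennreal ((p / q * A powr q * V powr (q / p)) powr (1 / q))"
    using assms by (simp add: epowr_ennreal)
  also have "(p / q * A powr q * V powr (q / p)) powr (1 / q)
      = (p / q) powr (1 / q) * A * V powr (1 / p)"
    unfolding powr_mult using assms by (simp add: powr_powr)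
  finally show ?thesis .
qed

text \<open>The rearrangement is at most \<open>A\<close> everywhere and vanishes from
  \<open>V\<close> on, so it is dominated by that of \<open>A\<close> times the indicator of a set
  of measure \<open>V\<close>.\<close>

lemma lorentz_norm_le:
  assumes "0 < p" "0 < q" "0 \<le> V"
    and A: "\<And>x. norm (f x) \<le> A"
    and S: "{x. f x \<noteq> 0} \<subseteq> S" "S \<in> sets lebesgue" "emeasure lebesgue S \<le> ennreal V"
  shows "lorentz_norm p q f \<le> ennreal (lorentz_const p q * A * V powr (1 / p))"
proof -
  have A0: "0 \<le> A" using A[of undefined] norm_ge_zero order_trans by blast
  have zero: "decr_rearr f u = 0" if "V \<le> u" for u
    using S that by (intro decr_rearr_eq_0) (auto intro: order_trans ennreal_leI)
  show ?thesis
  proof (cases "q = \<infinity>")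
    case True
    have "ennreal (u powr (1 / p)) * decr_rearr f u \<le> ennreal (A * V powr (1 / p))" if "0 < u" for u
    proof (cases "V \<le> u")
      case False
      have "ennreal (u powr (1 / p)) * decr_rearr f u \<le> ennreal (V powr (1 / p)) * ennreal A"
        using False that assms(1) by (intro mult_mono ennreal_leI powr_mono2 decr_rearr_le A) auto
      then show ?thesis using A0 by (simp add: ennreal_mult' mult.commute)
    qed (simp add: zero)
    then show ?thesis
      using True by (auto simp: lorentz_norm_def lorentz_const_def intro!: SUP_least)
  next
    case False
    then have q: "0 < enn2real q" using assms(2) by (simp add: enn2real_positive_iff less_top)
    have "(\<integral>\<^sup>+u\<in>{0<..}. epowr (ennreal (u powr (1 / p)) * decr_rearr f u) (enn2real q)
        * ennreal (1 / u) \<partial>lborel)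
      \<le> (\<integral>\<^sup>+u\<in>{0<..<V}. epowr (ennreal (u powr (1 / p)) * ennreal A) (enn2real q)
        * ennreal (1 / u) \<partial>lborel)"
    proof (rule nn_integral_mono)
      fix u :: real
      show "epowr (ennreal (u powr (1 / p)) * decr_rearr f u) (enn2real q) * ennreal (1 / u)
            * indicator {0<..} u
          \<le> epowr (ennreal (u powr (1 / p)) * ennreal A) (enn2real q) * ennreal (1 / u)
            * indicator {0<..<V} u"
        \<comment> \<open>For \<open>V \<le> u\<close> the base on the left is 0, and
          \<open>0 powr _ = 0\<close> makes the left integrand vanish.\<close>
        using q zero epowr_ennreal[of 0]
        by (cases "V \<le> u") (auto intro!: epowr_mono mult_mono decr_rearr_le A simp: indicator_def)
    qed
    then have "lorentz_norm p q f \<le> epowr (\<integral>\<^sup>+u\<in>{0<..<V}. epowr (ennreal (u powr (1 / p)) * ennreal A)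
        (enn2real q) * ennreal (1 / u) \<partial>lborel) (1 / enn2real q)"
      using False q by (auto simp: lorentz_norm_def intro!: epowr_mono)
    then show ?thesis
      using lorentz_integral[OF assms(1) q A0 assms(3)] False by (simp add: lorentz_const_def)
  qed
qed

lemma lorentz_norm_ge:
  assumes "0 < p" "0 < q" "0 \<le> A" "0 < V"
    and A: "\<And>x. x \<in> S \<Longrightarrow> norm (f x) = A" "\<And>x. x \<notin> S \<Longrightarrow> f x = 0"
    and S: "emeasure lebesgue S = ennreal V"
  shows "ennreal (lorentz_const p q * A * V powr (1 / p)) \<le> lorentz_norm p q f"
proof -
  have ge: "ennreal A \<le> decr_rearr f u" if "0 < u" "u < V" for u
    using decr_rearr_ge[of S f A V u] A S that by auto
  show ?thesis
  proof (cases "q = \<infinity>")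
    case True
    have le: "ennreal (u powr (1 / p) * A) \<le> lorentz_norm p q f" if "0 < u" "u < V" for u
    proof -
      have "ennreal (u powr (1 / p) * A) \<le> ennreal (u powr (1 / p)) * decr_rearr f u"
        using ge[OF that] by (simp add: ennreal_mult' mult_left_mono)
      also have "\<dots> \<le> lorentz_norm p q f"
        using True that by (auto simp: lorentz_norm_def intro!: SUP_upper)
      finally show ?thesis .
    qed
    \<comment> \<open>The rearrangement is known to be at least \<open>A\<close> only for
      \<open>u < V\<close>, so the value at \<open>V\<close> is reached as a limit from the
      left.\<close>
    have "((\<lambda>u. ennreal (u powr (1 / p) * A)) \<longlongrightarrow> ennreal (V powr (1 / p) * A)) (at_left V)"
      using assms by (intro tendsto_ennrealI tendsto_intros) auto
    moreover have "\<forall>\<^sub>F u in at_left V. ennreal (u powr (1 / p) * A) \<le> lorentz_norm p q f"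
      using eventually_at_left_real[OF assms(4)] by eventually_elim (auto intro: le)
    ultimately have "ennreal (V powr (1 / p) * A) \<le> lorentz_norm p q f"
      by (intro tendsto_upperbound) (auto simp: trivial_limit_at_left_real)
    then show ?thesis
      using True by (simp add: lorentz_const_def mult.commute)
  next
    case False
    then have q: "0 < enn2real q" using assms(2) by (simp add: enn2real_positive_iff less_top)
    have "(\<integral>\<^sup>+u\<in>{0<..<V}. epowr (ennreal (u powr (1 / p)) * ennreal A) (enn2real q)
        * ennreal (1 / u) \<partial>lborel)
      \<le> (\<integral>\<^sup>+u\<in>{0<..}. epowr (ennreal (u powr (1 / p)) * decr_rearr f u) (enn2real q)
        * ennreal (1 / u) \<partial>lborel)"
    proof (rule nn_integral_mono)
      fix u :: real
      show "epowr (ennreal (u powr (1 / p)) * ennreal A) (enn2real q) * ennreal (1 / u)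
            * indicator {0<..<V} u
          \<le> epowr (ennreal (u powr (1 / p)) * decr_rearr f u) (enn2real q) * ennreal (1 / u)
            * indicator {0<..} u"
        using q ge by (cases "0 < u \<and> u < V") (auto intro!: epowr_mono mult_mono)
    qed
    then have "epowr (\<integral>\<^sup>+u\<in>{0<..<V}. epowr (ennreal (u powr (1 / p)) * ennreal A)
        (enn2real q) * ennreal (1 / u) \<partial>lborel) (1 / enn2real q) \<le> lorentz_norm p q f"
      using False q by (auto simp: lorentz_norm_def intro!: epowr_mono)
    then show ?thesis
      using lorentz_integral[of p "enn2real q" A V] assms q False by (simp add: lorentz_const_def)
  qed
qed

subsection \<open>Sparse unit cubes in the dyadic grid\<close>

lemma dyadic_cube_sets [measurable]: "dyadic_cube j m \<in> sets lebesgue"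
proof -
  have "dyadic_cube j m = (\<Inter>i. {x. 2 powi (- j) * of_int (m $ i) \<le> x $ i
      \<and> x $ i < 2 powi (- j) * (of_int (m $ i) + 1)})"
    by (auto simp: dyadic_cube_def)
  also have "\<dots> \<in> sets borel" by (intro sets.finite_INT) auto
  finally show ?thesis by simp
qed

definition cube_vol :: "'n::finite itself \<Rightarrow> int \<Rightarrow> real" where
  "cube_vol _ j = 2 powr (- real_of_int j * real CARD('n))"

text \<open>The half-open cube is squeezed between an open and a closed box of the same
  volume.\<close>

lemma emeasure_dyadic_cube:
  "emeasure lebesgue (dyadic_cube j (m :: int ^ 'n::finite)) = ennreal (cube_vol TYPE('n) j)"
proof -
  define s :: real where "s = 2 powi (- j)"
  define a b :: "real ^ 'n" where "a = (\<chi> i. s * of_int (m $ i))"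
    and "b = (\<chi> i. s * (of_int (m $ i) + 1))"
  have s: "0 < s" by (simp add: s_def)
  have ab: "a \<bullet> i \<le> b \<bullet> i" "(b - a) \<bullet> i = s" if i: "i \<in> Basis" for i
    using i s by (auto simp: a_def b_def Basis_vec_def inner_axis algebra_simps)
  have sub: "box a b \<subseteq> dyadic_cube j m" "dyadic_cube j m \<subseteq> cbox a b"
    by (auto simp: dyadic_cube_def mem_box_cart a_def b_def s_def less_imp_le)
  have "(\<Prod>i\<in>(Basis :: (real ^ 'n) set). (b - a) \<bullet> i) = cube_vol TYPE('n) j"
  proof -
    have "s = 2 powr (- real_of_int j)"
      using powr_real_of_int'[of 2 "- j"] by (simp add: s_def)
    then have "s ^ CARD('n) = cube_vol TYPE('n) j" by (simp add: cube_vol_def powr_power mult.commute)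
    then show ?thesis by (simp add: ab(2))
  qed
  then have *: "emeasure lebesgue (box a b) = ennreal (cube_vol TYPE('n) j)"
      "emeasure lebesgue (cbox a b) = ennreal (cube_vol TYPE('n) j)"
    using ab by (simp_all add: emeasure_lborel_box_eq emeasure_lborel_cbox_eq)
  have "emeasure lebesgue (box a b) \<le> emeasure lebesgue (dyadic_cube j m)"
    by (intro emeasure_mono sub) simp
  moreover have "emeasure lebesgue (dyadic_cube j m) \<le> emeasure lebesgue (cbox a b)"
    by (intro emeasure_mono sub) simp
  ultimately show ?thesis unfolding * by (intro antisym)
qed

lemma cube_vol_pos: "0 < cube_vol T j"
  by (simp add: cube_vol_def)

lemma cube_vol_0 [simp]: "cube_vol T 0 = 1"
  by (simp add: cube_vol_def)

lemma cube_vol_le_1_iff: "cube_vol (T :: 'a::finite itself) j \<le> 1 \<longleftrightarrow> 0 \<le> j"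
  using powr_le_cancel_iff[of 2 "- real_of_int j * real CARD('a)" 0]
  by (simp add: cube_vol_def zero_le_mult_iff)

lemma measure_dyadic_cube:
  "measure lebesgue (dyadic_cube j (m :: int ^ 'n::finite)) = cube_vol TYPE('n) j"
  using cube_vol_pos[of "TYPE('n)" j] by (simp add: measure_def emeasure_dyadic_cube less_imp_le)

text \<open>One coarse side is \<open>D\<close> fine sides long. After division by the fine side
  length \<open>s\<close> the common point \<open>x\<close> yields strict inequalities between
  integers, and these sharpen to the non-strict ones between endpoints.\<close>

lemma dyadic_interval_nested:
  fixes a b j j' :: int and x :: real
  assumes "j \<le> j'"
    and "2 powi (- j) * of_int a \<le> x" "x < 2 powi (- j) * (of_int a + 1)"
    and "2 powi (- j') * of_int b \<le> x" "x < 2 powi (- j') * (of_int b + 1)"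
  shows "2 powi (- j) * of_int a \<le> (2 powi (- j') * of_int b :: real)"
    and "2 powi (- j') * (of_int b + 1) \<le> (2 powi (- j) * (of_int a + 1) :: real)"
proof -
  define s :: real where "s = 2 powi (- j')"
  define D :: int where "D = 2 ^ nat (j' - j)"
  have s: "0 < s" by (simp add: s_def)
  have *: "2 powi (- j) = s * real_of_int D"
  proof -
    have "(2::real) powi (- j) = 2 powi (- j') * 2 powi (j' - j)"
      by (subst power_int_add[symmetric]) auto
    also have "(2::real) powi (j' - j) = real_of_int D"
      using assms(1) by (simp add: D_def power_int_def)
    finally show ?thesis by (simp add: s_def)
  qed
  have "s * real_of_int (D * a) < s * real_of_int (b + 1)"
    using assms(2,5) * by (simp add: s_def[symmetric] mult.assoc)
  then have "D * a < b + 1" using s by (simp add: mult_less_cancel_left_pos del: of_int_mult of_int_add)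
  then have "D * a \<le> b" by simp
  have "s * real_of_int b < s * real_of_int (D * (a + 1))"
    using assms(3,4) * by (simp add: s_def[symmetric] mult.assoc)
  then have "b < D * (a + 1)" using s by (simp add: mult_less_cancel_left_pos del: of_int_mult of_int_add)
  then have "b + 1 \<le> D * (a + 1)" by simp
  have "s * real_of_int (D * a) \<le> s * real_of_int b"
    using \<open>D * a \<le> b\<close> s by (intro mult_left_mono) (simp_all del: of_int_mult)
  then show "2 powi (- j) * of_int a \<le> (2 powi (- j') * of_int b :: real)"
    using * by (simp add: s_def[symmetric] mult.assoc)
  have "s * real_of_int (b + 1) \<le> s * real_of_int (D * (a + 1))"
    using \<open>b + 1 \<le> D * (a + 1)\<close> s by (intro mult_left_mono) (simp_all del: of_int_mult of_int_add)
  then show "2 powi (- j') * (of_int b + 1) \<le> (2 powi (- j) * (of_int a + 1) :: real)"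
    using * by (simp add: s_def[symmetric] mult.assoc)
qed

lemma dyadic_cube_nested:
  assumes "j \<le> j'" "dyadic_cube j m \<inter> dyadic_cube j' m' \<noteq> {}"
  shows "dyadic_cube j' m' \<subseteq> dyadic_cube j m"
proof -
  obtain x where x: "x \<in> dyadic_cube j m" "x \<in> dyadic_cube j' m'" using assms(2) by auto
  show ?thesis
  proof
    fix y assume "y \<in> dyadic_cube j' m'"
    then show "y \<in> dyadic_cube j m"
      using x dyadic_interval_nested[OF assms(1), of "m $ i" "x $ i" "m' $ i" for i]
      unfolding dyadic_cube_def mem_Collect_eq by (meson order_trans order_less_le_trans)
  qed
qed

lemma dyadic_cube_disjoint:
  assumes "dyadic_cube j m \<noteq> dyadic_cube j m'"
  shows "dyadic_cube j m \<inter> dyadic_cube j m' = {}"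
  using assms dyadic_cube_nested[of j j m m'] dyadic_cube_nested[of j j m' m]
  by (metis Int_commute order_refl subset_antisym)

lemma dyadic_cube_nonempty: "dyadic_cube j (m :: int ^ 'a::finite) \<noteq> {}"
proof
  assume "dyadic_cube j m = {}"
  then have "ennreal (cube_vol TYPE('a) j) = 0"
    using emeasure_dyadic_cube[of j m] by simp
  then show False using cube_vol_pos[of "TYPE('a)" j] by simp
qed

section \<open>Unit cubes carrying the coefficients, and the resulting step function\<close>

definition tower_cube :: "nat \<Rightarrow> (real ^ 'n) set" where
  "tower_cube k = dyadic_cube 0 (\<chi> i. 2 ^ k)"

lemma mem_tower_cube: "x \<in> tower_cube k \<longleftrightarrow> (\<forall>i. 2 ^ k \<le> x $ i \<and> x $ i < 2 ^ k + 1)"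
  by (simp add: tower_cube_def dyadic_cube_def)

lemma tower_cube_sets [measurable]: "tower_cube k \<in> sets lebesgue"
  by (simp add: tower_cube_def)

lemma emeasure_tower_cube: "emeasure lebesgue (tower_cube k :: (real ^ 'n::finite) set) = 1"
  by (simp add: tower_cube_def emeasure_dyadic_cube)

text \<open>The floor of any coordinate of a point of the cube recovers its index.\<close>

lemma tower_cube_eq:
  assumes "x \<in> tower_cube k" "x \<in> tower_cube l"
  shows "k = l"
proof -
  have "\<lfloor>x $ i\<rfloor> = 2 ^ k" "\<lfloor>x $ i\<rfloor> = 2 ^ l" for i
    using assms by (auto simp: mem_tower_cube floor_eq_iff)
  then have "(2::int) ^ k = 2 ^ l" by simp
  then show ?thesis by simp
qed

text \<open>Both cubes are dyadic, so once they meet the smaller lies in the larger, and the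
  intersection has the smaller of the two volumes.\<close>

lemma dyadic_cube_Int_tower_cube:
  fixes m :: "int ^ 'n::finite"
  assumes "dyadic_cube j m \<inter> tower_cube k \<noteq> {}"
  shows "0 \<le> j \<Longrightarrow> dyadic_cube j m \<subseteq> tower_cube k"
    and "j \<le> 0 \<Longrightarrow> tower_cube k \<subseteq> dyadic_cube j m"
    and "emeasure lebesgue (dyadic_cube j m \<inter> tower_cube k) = ennreal (min 1 (cube_vol TYPE('n) j))"
proof -
  show 1: "dyadic_cube j m \<subseteq> tower_cube k" if "0 \<le> j"
    using that assms unfolding tower_cube_def by (intro dyadic_cube_nested) auto
  show 2: "tower_cube k \<subseteq> dyadic_cube j m" if "j \<le> 0"
    using that assms unfolding tower_cube_def by (intro dyadic_cube_nested) auto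
  show "emeasure lebesgue (dyadic_cube j m \<inter> tower_cube k) = ennreal (min 1 (cube_vol TYPE('n) j))"
  proof (cases "0 \<le> j")
    case True
    then show ?thesis
      using 1 cube_vol_le_1_iff[of "TYPE('n)" j] by (simp add: Int_absorb2 emeasure_dyadic_cube)
  next
    case False
    then show ?thesis
      using 2 cube_vol_le_1_iff[of "TYPE('n)" j]
      by (simp add: Int_absorb1 emeasure_tower_cube)
  qed
qed

text \<open>A cube of side at most 1 lies inside every unit cube that it meets, and these are
  disjoint. A larger cube contains the corners of those it meets, so its side interval contains the
  powers \<open>2 ^ k\<close>: near the origin only exponents below N fit, and elsewhere at most
  one.\<close>

lemma card_tower_cubes_le:
  fixes m :: "int ^ 'n::finite" and j :: int
  defines "K \<equiv> {k. dyadic_cube j m \<inter> tower_cube k \<noteq> {}}"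
  shows "finite K \<and> card K \<le> nat (- j) + 1"
proof -
  \<comment> \<open>Covers both cases in which at most one unit cube is met.\<close>
  have small: "finite K \<and> card K \<le> nat (- j) + 1" if "\<And>k l. k \<in> K \<Longrightarrow> l \<in> K \<Longrightarrow> k = l"
  proof -
    have "\<exists>k. K \<subseteq> {k}" using that by (cases "K = {}") blast+
    then obtain k where "K \<subseteq> {k}" by blast
    then show ?thesis
      using card_mono[of "{k}" K] by (auto intro: finite_subset)
  qed
  show ?thesis
  proof (cases "0 \<le> j")
    case True
    obtain x where "x \<in> dyadic_cube j m" using dyadic_cube_nonempty by blast
    then have "x \<in> tower_cube k" if "k \<in> K" for k
      using that True dyadic_cube_Int_tower_cube(1) unfolding K_def by blast
    then show ?thesis using tower_cube_eq by (intro small) blast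
  next
    case False
    define N where "N = nat (- j)"
    have pow: "(2::real) powi (- j) = 2 ^ N" using False by (simp add: N_def power_int_def)
    \<comment> \<open>All corners lie on the diagonal, so the constraint in a single coordinate
      suffices.\<close>
    fix i :: 'n
    have K: "2 ^ N * (m $ i) \<le> 2 ^ k \<and> 2 ^ k < 2 ^ N * (m $ i + 1)" if "k \<in> K" for k
    proof -
      have "(\<chi> i. 2 ^ k) \<in> (tower_cube k :: (real ^ 'n) set)" by (simp add: mem_tower_cube)
      then have "(\<chi> i. 2 ^ k) \<in> dyadic_cube j m"
        using that False dyadic_cube_Int_tower_cube(2)[of j m k] by (auto simp: K_def)
      then have "2 ^ N * real_of_int (m $ i) \<le> 2 ^ k \<and> 2 ^ k < 2 ^ N * (real_of_int (m $ i) + 1)"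
        by (simp add: dyadic_cube_def pow)
      then have "real_of_int (2 ^ N * (m $ i)) \<le> real_of_int (2 ^ k)
          \<and> real_of_int (2 ^ k) < real_of_int (2 ^ N * (m $ i + 1))" by simp
      then show ?thesis by (simp only: of_int_le_iff of_int_less_iff)
    qed
    show ?thesis
    proof (cases "m $ i \<le> 0")
      case True
      \<comment> \<open>The side interval ends at or below \<open>2 ^ N\<close>.\<close>
      have "k < N" if "k \<in> K" for k
      proof -
        have "(2::int) ^ k < 2 ^ N * (m $ i + 1)" using K[OF that] by simp
        also have "\<dots> \<le> 2 ^ N * 1" using True by (intro mult_left_mono) auto
        finally show ?thesis by simp
      qed
      then have "K \<subseteq> {..<N}" by auto
      then show ?thesis
        using card_mono[of "{..<N}" K] finite_subset[of K "{..<N}"] by (simp add: N_def)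
    next
      case False
      \<comment> \<open>Since \<open>m $ i \<ge> 1\<close>, the endpoints of the side interval are
        within a factor 2 of each other, and the interval is half-open; two distinct powers of 2 do
        not fit.\<close>
      have le: "l \<le> k" if "k \<in> K" "l \<in> K" for k l
      proof -
        have "(2::int) ^ l < 2 ^ N * (m $ i + 1)" using K[OF that(2)] by simp
        also have "\<dots> \<le> 2 ^ N * (2 * m $ i)" using False by (intro mult_left_mono) auto
        also have "\<dots> \<le> 2 ^ Suc k" using K[OF that(1)] by simp
        finally have "l < Suc k" by (subst (asm) power_strict_increasing_iff) auto
        then show ?thesis by simp
      qed
      show ?thesis by (rule small) (auto intro: antisym le)
    qed
  qed
qed

text \<open>The description is well defined because the unit cubes are pairwise disjoint. At each
  point the value is one coefficient or 0, which makes the map linear.\<close>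

definition spread :: "(nat \<Rightarrow> 'k::zero) \<Rightarrow> real ^ 'n \<Rightarrow> 'k" where
  "spread a x = (if \<exists>k. x \<in> tower_cube k then a (THE k. x \<in> tower_cube k) else 0)"

lemma spread_in: "x \<in> tower_cube k \<Longrightarrow> spread a x = a k"
  unfolding spread_def by (auto intro!: arg_cong[of _ _ a] dest: tower_cube_eq)

lemma spread_out: "(\<And>k. x \<notin> tower_cube k) \<Longrightarrow> spread a x = 0"
  by (simp add: spread_def)

lemma measurable_spread [measurable]:
  fixes a :: "nat \<Rightarrow> 'k::{second_countable_topology, real_normed_vector}"
  shows "(spread a :: real ^ 'n::finite \<Rightarrow> 'k) \<in> borel_measurable lebesgue"
proof (rule measurableI)
  fix B :: "'k set" assume "B \<in> sets borel"
  \<comment> \<open>A preimage is a countable union of cubes, joined by the complement of all cubes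
    when it has to contain the zero set.\<close>
  have "(spread a :: real ^ 'n \<Rightarrow> 'k) -` B \<inter> space lebesgue
      = (\<Union>k\<in>{k. a k \<in> B}. tower_cube k) \<union> (if 0 \<in> B then - (\<Union>k. tower_cube k) else {})"
    (is "?L = ?R")
  proof (rule set_eqI)
    fix x :: "real ^ 'n"
    show "x \<in> ?L \<longleftrightarrow> x \<in> ?R"
    proof (cases "\<exists>k. x \<in> tower_cube k")
      case True
      then obtain k where k: "x \<in> tower_cube k" ..
      then have "x \<in> tower_cube l \<longleftrightarrow> l = k" for l using tower_cube_eq by blast
      then show ?thesis using k by (auto simp: spread_in)
    qed (auto simp: spread_out)
  qed
  also have "?R \<in> sets lebesgue"
  proof -
    have U: "(\<Union>k\<in>I. tower_cube k) \<in> sets (lebesgue :: (real ^ 'n) measure)" for I by auto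
    then have "- (\<Union>k. tower_cube k) \<in> sets (lebesgue :: (real ^ 'n) measure)"
      using sets.compl_sets[OF U[of UNIV]] by (simp add: Compl_eq_Diff_UNIV)
    then show ?thesis by (auto intro!: sets.Un U)
  qed
  finally show "(spread a :: real ^ 'n \<Rightarrow> 'k) -` B \<inter> space lebesgue \<in> sets lebesgue" .
qed auto

subsection \<open>Decay over dyadic levels\<close>

text \<open>Half of the exponential decay absorbs the polynomial factor, and the other half remains
  as a geometric ratio.\<close>

lemma powr_decay_bounded:
  fixes \<alpha> \<beta> :: real
  assumes "0 < \<alpha>"
  obtains B where "1 \<le> B"
    "\<And>N::nat. 2 powr (- \<alpha> * real N) * (real N + 1) powr \<beta> \<le> B * (2 powr (- \<alpha> / 2)) ^ N"
proof -
  define \<gamma> where "\<gamma> = \<alpha> / 2"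
  have \<gamma>: "0 < \<gamma>" using assms by (simp add: \<gamma>_def)
  have "(\<lambda>N. 2 powr (- \<gamma> * real N) * (real N + 1) powr \<beta>) \<longlonglongrightarrow> 0"
    using \<gamma> by real_asymp
  then have "Bseq (\<lambda>N. 2 powr (- \<gamma> * real N) * (real N + 1) powr \<beta>)"
    by (rule convergentI[THEN convergent_imp_Bseq])
  then obtain B where B: "\<And>N. 2 powr (- \<gamma> * real N) * (real N + 1) powr \<beta> \<le> B"
    unfolding Bseq_def by (auto simp: abs_le_iff)
  show ?thesis
  proof
    fix N :: nat
    have "2 powr (- \<alpha> * real N) * (real N + 1) powr \<beta>
        = (2 powr (- \<gamma> * real N) * (real N + 1) powr \<beta>) * (2 powr (- \<gamma>)) ^ N"
      by (simp add: powr_power \<gamma>_def field_simps flip: powr_add)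
    also have "\<dots> \<le> max 1 B * (2 powr (- \<gamma>)) ^ N"
      using B[of N] by (intro mult_right_mono) auto
    finally show "2 powr (- \<alpha> * real N) * (real N + 1) powr \<beta> \<le> max 1 B * (2 powr (- \<alpha> / 2)) ^ N"
      by (simp add: \<gamma>_def)
  qed simp
qed

text \<open>The absolute value is injective on the nonnegative and on the negative integers, so each
  half is dominated by one geometric series.\<close>

lemma sum_power_abs_int_le:
  fixes \<rho> :: real and J :: "int set"
  assumes "0 \<le> \<rho>" "\<rho> < 1" "finite J"
  shows "(\<Sum>j\<in>J. \<rho> ^ nat \<bar>j\<bar>) \<le> 2 / (1 - \<rho>)"
proof -
  have *: "(\<Sum>j\<in>I. \<rho> ^ nat \<bar>j\<bar>) \<le> 1 / (1 - \<rho>)"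
    if "finite I" "inj_on (\<lambda>j. nat \<bar>j\<bar>) I" for I :: "int set"
  proof -
    have "(\<Sum>j\<in>I. \<rho> ^ nat \<bar>j\<bar>) = (\<Sum>k\<in>(\<lambda>j. nat \<bar>j\<bar>) ` I. \<rho> ^ k)"
      using that by (simp add: sum.reindex)
    also have "\<dots> \<le> (\<Sum>k. \<rho> ^ k)"
      using assms that by (intro sum_le_suminf) auto
    finally show ?thesis using assms by (simp add: suminf_geometric)
  qed
  have "(\<Sum>j\<in>J. \<rho> ^ nat \<bar>j\<bar>)
      = (\<Sum>j\<in>J \<inter> {0..}. \<rho> ^ nat \<bar>j\<bar>) + (\<Sum>j\<in>J - {0..}. \<rho> ^ nat \<bar>j\<bar>)"
    using assms(3) by (rule sum.Int_Diff)
  also have "\<dots> \<le> 1 / (1 - \<rho>) + 1 / (1 - \<rho>)"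
    using assms(3) by (intro add_mono *) (auto simp: inj_on_def)
  finally show ?thesis by simp
qed

text \<open>The Morrey weight of a cube of level \<open>j\<close>, times the power
  \<open>1 / p\<close> of the bound on the measure of the part of it covered by unit cubes: at most
  \<open>nat (- j) + 1\<close> pieces of measure \<open>min 1 (cube_vol T j)\<close> each.\<close>

definition level_weight :: "'n::finite itself \<Rightarrow> real \<Rightarrow> real \<Rightarrow> int \<Rightarrow> real" where
  "level_weight T p t j = cube_vol T j powr (1 / t - 1 / p)
     * (real (nat (- j) + 1) * min 1 (cube_vol T j)) powr (1 / p)"

lemma level_weight_nonneg: "0 \<le> level_weight T p t j"
  by (simp add: level_weight_def)

text \<open>For \<open>j \<ge> 0\<close> the quotient is
  \<open>cube_vol T j powr (r / t - 1)\<close>, which decays because t < r. For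
  \<open>j = - N < 0\<close> the volume power decays like \<open>2 powr (- \<alpha> * N)\<close>
  because p < t, against the factor \<open>(N + 1) powr (r / p)\<close> from the count. The divisor
  is the price of bounding a coefficient by an integral over the cube.\<close>

lemma level_weight_decay:
  fixes T :: "'n::finite itself"
  assumes "0 < p" "p < t" "t < r"
  obtains B \<rho> where "1 \<le> B" "0 \<le> \<rho>" "\<rho> < 1"
    "\<And>j. level_weight T p t j powr r / min 1 (cube_vol T j) \<le> B * \<rho> ^ nat \<bar>j\<bar>"
proof -
  define n where "n = real CARD('n)"
  have n: "0 < n" by (simp add: n_def)
  define \<alpha> where "\<alpha> = n * r * (1 / p - 1 / t)"
  have \<alpha>: "0 < \<alpha>" using assms n by (simp add: \<alpha>_def field_simps)
  obtain B where B: "1 \<le> B" "\<And>N::nat. 2 powr (- \<alpha> * real N) * (real N + 1) powr (r / p)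
      \<le> B * (2 powr (- \<alpha> / 2)) ^ N"
    using powr_decay_bounded[OF \<alpha>] by blast
  define \<delta> where "\<delta> = n * (r / t - 1)"
  have \<delta>: "0 < \<delta>" using assms n by (simp add: \<delta>_def)
  \<comment> \<open>The slower of the two decay rates, for small and for large cubes.\<close>
  define \<rho> :: real where "\<rho> = max (2 powr (- \<delta>)) (2 powr (- \<alpha> / 2))"
  have lt1: "2 powr x < (1::real)" if "x < 0" for x
    using powr_less_mono[of x 0 "2::real"] that by simp
  show ?thesis
  proof (rule that)
    show "0 \<le> \<rho>" "\<rho> < 1" using \<alpha> \<delta> lt1 by (auto simp: \<rho>_def le_max_iff_disj)
    show "level_weight T p t j powr r / min 1 (cube_vol T j) \<le> B * \<rho> ^ nat \<bar>j\<bar>" for j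
    proof (cases "0 \<le> j")
      case True
      define k where "k = nat j"
      have j: "j = int k" using True by (simp add: k_def)
      have min: "min 1 (cube_vol T j) = cube_vol T j"
        using cube_vol_le_1_iff[of T j] True by simp
      \<comment> \<open>Here \<open>nat (- j) = 0\<close>, so the count is 1 and the exponents of
        the volume add up.\<close>
      have "level_weight T p t j = cube_vol T j powr (1 / t)"
        using True cube_vol_pos[of T j] by (simp add: level_weight_def min flip: powr_add)
      then have "level_weight T p t j powr r / min 1 (cube_vol T j) = cube_vol T j powr (r / t - 1)"
        using cube_vol_pos[of T j] by (simp add: min powr_powr powr_diff)
      also have "\<dots> = (2 powr (- \<delta>)) ^ k"
        by (simp add: cube_vol_def powr_powr powr_power j \<delta>_def n_def mult_ac)
      also have "\<dots> \<le> \<rho> ^ k" by (intro power_mono) (auto simp: \<rho>_def)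
      also have "\<dots> \<le> B * \<rho> ^ k"
        using B(1) \<open>0 \<le> \<rho>\<close> by (simp add: mult_le_cancel_right1 zero_le_power not_less)
      finally show ?thesis by (simp add: j)
    next
      case False
      define N where "N = nat (- j)"
      have j: "j = - int N" using False by (simp add: N_def)
      have min: "min 1 (cube_vol T j) = 1"
        using cube_vol_le_1_iff[of T j] False by simp
      have "level_weight T p t j powr r
          = cube_vol T j powr (r * (1 / t - 1 / p)) * (real N + 1) powr (r / p)"
        by (simp add: level_weight_def min[unfolded j] powr_mult powr_powr j mult.commute add.commute)
      also have "cube_vol T j powr (r * (1 / t - 1 / p)) = 2 powr (- \<alpha> * real N)"
        by (simp add: cube_vol_def powr_powr j \<alpha>_def n_def algebra_simps)
      finally have "level_weight T p t j powr r / min 1 (cube_vol T j)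
          \<le> B * (2 powr (- \<alpha> / 2)) ^ N"
        using B(2)[of N] by (simp add: min)
      also have "\<dots> \<le> B * \<rho> ^ N"
        using B(1) by (intro mult_left_mono power_mono) (auto simp: \<rho>_def)
      finally show ?thesis by (simp add: j)
    qed
  qed (rule B(1))
qed

text \<open>Serves the case of infinite r. The decay estimate is applied with the auxiliary finite
  exponent \<open>t + 1\<close>, which exceeds \<open>t\<close>, and a root is taken.\<close>

lemma level_weight_bounded:
  fixes T :: "'n::finite itself"
  assumes "0 < p" "p < t"
  obtains B where "0 < B" "\<And>j. level_weight T p t j \<le> B"
proof -
  obtain B \<rho> where B: "1 \<le> B" "0 \<le> \<rho>" "\<rho> < 1"
    "\<And>j. level_weight T p t j powr (t + 1) / min 1 (cube_vol T j) \<le> B * \<rho> ^ nat \<bar>j\<bar>"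
    using level_weight_decay[OF assms, of "t + 1" T] by auto
  show ?thesis
  proof
    fix j
    have min: "0 < min 1 (cube_vol T j)" using cube_vol_pos[of T j] by simp
    have "level_weight T p t j powr (t + 1) \<le> level_weight T p t j powr (t + 1) / min 1 (cube_vol T j)"
      using min by (simp add: le_divide_eq mult_left_le)
    also have "\<dots> \<le> B * 1"
      using B(1-3) by (intro order_trans[OF B(4)] mult_left_mono power_le_one) auto
    finally have "(level_weight T p t j powr (t + 1)) powr (1 / (t + 1)) \<le> B powr (1 / (t + 1))"
      using assms by (intro powr_mono2) auto
    then show "level_weight T p t j \<le> B powr (1 / (t + 1))"
      using assms level_weight_nonneg[of T p t j] by (simp add: powr_powr)
  qed (use B(1) in simp)
qed

section \<open>Estimates on a single dyadic cube\<close>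

lemma lorentz_norm_on_spread_le:
  fixes m :: "int ^ 'n::finite" and a :: "nat \<Rightarrow> 'k::real_normed_vector"
  assumes "0 < p" "0 < q" "0 \<le> A"
    and A: "\<And>k. dyadic_cube j m \<inter> tower_cube k \<noteq> {} \<Longrightarrow> norm (a k) \<le> A"
  shows "lorentz_norm_on p q (dyadic_cube j m) (spread a)
    \<le> ennreal (lorentz_const p q * A
        * (real (nat (- j) + 1) * min 1 (cube_vol TYPE('n) j)) powr (1 / p))"
proof -
  define K where "K = {k. dyadic_cube j m \<inter> tower_cube k \<noteq> {}}"
  have K: "finite K" "card K \<le> nat (- j) + 1" using card_tower_cubes_le[of j m] by (auto simp: K_def)
  define S where "S = (\<Union>k\<in>K. dyadic_cube j m \<inter> tower_cube k)"
  have "emeasure lebesgue S \<le> (\<Sum>k\<in>K. emeasure lebesgue (dyadic_cube j m \<inter> tower_cube k))"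
    unfolding S_def using K by (intro emeasure_subadditive_finite) auto
  also have "\<dots> = (\<Sum>k\<in>K. ennreal (min 1 (cube_vol TYPE('n) j)))"
    by (intro sum.cong refl dyadic_cube_Int_tower_cube(3)) (simp add: K_def)
  also have "\<dots> = ennreal (real (card K) * min 1 (cube_vol TYPE('n) j))"
    using cube_vol_pos[of "TYPE('n)" j] by (simp add: ennreal_mult ennreal_of_nat_eq_real_of_nat)
  also have "\<dots> \<le> ennreal (real (nat (- j) + 1) * min 1 (cube_vol TYPE('n) j))"
    using cube_vol_pos[of "TYPE('n)" j] K(2) by (intro ennreal_leI mult_right_mono) auto
  finally have S: "emeasure lebesgue S \<le> \<dots>" .
  show ?thesis
    unfolding lorentz_norm_on_def
  proof (rule lorentz_norm_le)
    fix x :: "real ^ 'n"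
    show "norm (indicat_real (dyadic_cube j m) x *\<^sub>R spread a x) \<le> A"
    proof (cases "x \<in> dyadic_cube j m \<and> (\<exists>k. x \<in> tower_cube k)")
      case True
      then obtain k where "x \<in> dyadic_cube j m" "x \<in> tower_cube k" by blast
      then show ?thesis using A[of k] by (auto simp: spread_in)
    qed (use \<open>0 \<le> A\<close> in \<open>auto simp: spread_out indicator_def\<close>)
  next
    show "{x. indicat_real (dyadic_cube j m) x *\<^sub>R spread a x \<noteq> 0} \<subseteq> S"
    proof clarify
      fix x assume "indicat_real (dyadic_cube j m) x *\<^sub>R spread a x \<noteq> 0"
      then have "x \<in> dyadic_cube j m" "\<exists>k. x \<in> tower_cube k"
        using spread_out[of x a] by (auto simp: indicator_def split: if_splits)
      then show "x \<in> S" by (auto simp: S_def K_def)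
    qed
    show "S \<in> sets lebesgue" unfolding S_def using K by auto
  qed (use assms S cube_vol_pos[of "TYPE('n)" j] in auto)
qed

lemma lorentz_norm_on_spread_tower_cube_ge:
  fixes a :: "nat \<Rightarrow> 'k::real_normed_vector"
  assumes "0 < p" "0 < q"
  shows "ennreal (lorentz_const p q * norm (a k))
    \<le> lorentz_norm_on p q (tower_cube k :: (real ^ 'n::finite) set) (spread a)"
  using lorentz_norm_ge[OF assms, of "norm (a k)" 1 "tower_cube k :: (real ^ 'n) set"
      "\<lambda>x. indicat_real (tower_cube k) x *\<^sub>R spread a x"]
  by (auto simp: lorentz_norm_on_def emeasure_tower_cube spread_in)

lemma nn_integral_spread:
  fixes a :: "nat \<Rightarrow> 'k::{second_countable_topology, real_normed_vector}"
  assumes "0 < r"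
  shows "(\<integral>\<^sup>+x. ennreal (norm (spread a (x :: real ^ 'n::finite)) powr r) \<partial>lebesgue)
    = (\<Sum>k. ennreal (norm (a k) powr r))"
proof -
  have "ennreal (norm (spread a x) powr r)
      = (\<Sum>k. ennreal (norm (a k) powr r) * indicator (tower_cube k) x)" for x :: "real ^ 'n"
  proof (cases "\<exists>k. x \<in> tower_cube k")
    case True
    then obtain k where k: "x \<in> tower_cube k" ..
    then have "x \<in> tower_cube l \<longleftrightarrow> l = k" for l using tower_cube_eq by blast
    then have "ennreal (norm (a l) powr r) * indicator (tower_cube l) x
        = (if l = k then ennreal (norm (a l) powr r) else 0)" for l
      by (simp add: indicator_def)
    then show ?thesis
      using sums_single[of k "\<lambda>l. ennreal (norm (a l) powr r)"] k
      by (simp add: sums_iff spread_in)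
  qed (simp add: spread_out)
  then have "(\<integral>\<^sup>+x. ennreal (norm (spread a (x :: real ^ 'n)) powr r) \<partial>lebesgue)
      = (\<integral>\<^sup>+(x :: real ^ 'n). (\<Sum>k. ennreal (norm (a k) powr r) * indicator (tower_cube k) x) \<partial>lebesgue)"
    by simp
  also have "\<dots> = (\<Sum>k. \<integral>\<^sup>+(x :: real ^ 'n). ennreal (norm (a k) powr r) * indicator (tower_cube k) x \<partial>lebesgue)"
    by (intro nn_integral_suminf) auto
  also have "\<dots> = (\<Sum>k. ennreal (norm (a k) powr r))"
    by (simp add: nn_integral_cmult_indicator emeasure_tower_cube)
  finally show ?thesis .
qed

text \<open>Trades a single coefficient for an integral over the cube, a quantity that is additive
  over disjoint cubes.\<close>

lemma nn_integral_spread_cube_ge: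
  fixes m :: "int ^ 'n::finite"
  assumes "dyadic_cube j m \<inter> tower_cube k \<noteq> {}"
  shows "ennreal (norm (a k) powr r * min 1 (cube_vol TYPE('n) j))
    \<le> (\<integral>\<^sup>+x\<in>dyadic_cube j m. ennreal (norm (spread a x) powr r) \<partial>lebesgue)"
proof -
  have "ennreal (norm (a k) powr r * min 1 (cube_vol TYPE('n) j))
      = (\<integral>\<^sup>+x. ennreal (norm (a k) powr r) * indicator (dyadic_cube j m \<inter> tower_cube k) x \<partial>lebesgue)"
    using cube_vol_pos[of "TYPE('n)" j]
    by (simp add: nn_integral_cmult_indicator dyadic_cube_Int_tower_cube(3)[OF assms] ennreal_mult')
  also have "\<dots> \<le> (\<integral>\<^sup>+x\<in>dyadic_cube j m. ennreal (norm (spread a x) powr r) \<partial>lebesgue)"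
    by (intro nn_integral_mono) (auto simp: indicator_def spread_in)
  finally show ?thesis .
qed

subsection \<open>The embedding\<close>

lemma sum_nn_integral_dyadic_cubes_le:
  fixes g :: "real ^ 'n::finite \<Rightarrow> ennreal"
  assumes "g \<in> borel_measurable lebesgue" "finite F" "\<And>Q. Q \<in> F \<Longrightarrow> \<exists>m. Q = dyadic_cube j m"
  shows "(\<Sum>Q\<in>F. \<integral>\<^sup>+x\<in>Q. g x \<partial>lebesgue) \<le> (\<integral>\<^sup>+x. g x \<partial>lebesgue)"
proof -
  have sets: "Q \<in> sets lebesgue" if "Q \<in> F" for Q using assms(3)[OF that] by auto
  have disj: "disjoint_family_on (\<lambda>Q. Q) F"
    unfolding disjoint_family_on_def using assms(3) dyadic_cube_disjoint by metis
  have "(\<Sum>Q\<in>F. \<integral>\<^sup>+x\<in>Q. g x \<partial>lebesgue) = (\<integral>\<^sup>+x. (\<Sum>Q\<in>F. g x * indicator Q x) \<partial>lebesgue)"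
    using sets assms(1) by (intro nn_integral_sum[symmetric]) auto
  also have "\<dots> = (\<integral>\<^sup>+x. g x * indicator (\<Union>Q\<in>F. Q) x \<partial>lebesgue)"
    using assms(2) disj
    by (intro nn_integral_cong) (subst indicator_UN_disjoint, auto simp: sum_distrib_left)
  also have "\<dots> \<le> (\<integral>\<^sup>+x. g x \<partial>lebesgue)"
    by (intro nn_integral_mono) (auto simp: indicator_def)
  finally show ?thesis .
qed

text \<open>Only finitely many unit cubes are met, so the largest norm is attained at some index,
  whose unit cube alone gives the integral bound. If none is met, \<open>A = 0\<close>
  works.\<close>

lemma spread_cube_bound:
  fixes m :: "int ^ 'n::finite" and a :: "nat \<Rightarrow> 'k::real_normed_vector"
  obtains A where "0 \<le> A" "\<And>k. dyadic_cube j m \<inter> tower_cube k \<noteq> {} \<Longrightarrow> norm (a k) \<le> A"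
    and "ennreal (A powr r * min 1 (cube_vol TYPE('n) j))
      \<le> (\<integral>\<^sup>+x\<in>dyadic_cube j m. ennreal (norm (spread a x) powr r) \<partial>lebesgue)"
proof -
  define K where "K = {k. dyadic_cube j m \<inter> tower_cube k \<noteq> {}}"
  have "finite K" using card_tower_cubes_le[of j m] by (simp add: K_def)
  show ?thesis
  proof (cases "K = {}")
    case True
    then show ?thesis by (intro that[of 0]) (auto simp: K_def)
  next
    case False
    have "Max ((\<lambda>k. norm (a k)) ` K) \<in> (\<lambda>k. norm (a k)) ` K"
      using \<open>finite K\<close> False by (intro Max_in) auto
    then obtain k where "k \<in> K" and k: "norm (a k) = Max ((\<lambda>k. norm (a k)) ` K)" by auto
    have "norm (a l) \<le> norm (a k)" if "l \<in> K" for l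
      unfolding k using \<open>finite K\<close> that by (intro Max_ge) auto
    then show ?thesis
      using \<open>k \<in> K\<close> nn_integral_spread_cube_ge[of j m k a r]
      by (intro that[of "norm (a k)"]) (simp_all add: K_def)
  qed
qed

lemma spread_cube_term_le:
  fixes m :: "int ^ 'n::finite" and a :: "nat \<Rightarrow> 'k::real_normed_vector"
  assumes "0 < p" "0 < q" "0 < r"
  shows "ennreal (cube_vol TYPE('n) j powr (r / t - r / p))
        * epowr (lorentz_norm_on p q (dyadic_cube j m) (spread a)) r
    \<le> ennreal (lorentz_const p q powr r
        * (level_weight TYPE('n) p t j powr r / min 1 (cube_vol TYPE('n) j)))
      * (\<integral>\<^sup>+x\<in>dyadic_cube j m. ennreal (norm (spread a x) powr r) \<partial>lebesgue)"
proof -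
  define v where "v = cube_vol TYPE('n) j"
  define c where "c = lorentz_const p q"
  define V where "V = real (nat (- j) + 1) * min 1 v"
  have pos: "0 < v" "0 < c" "0 \<le> V" "0 < min 1 v"
    using cube_vol_pos[of "TYPE('n)" j] lorentz_const_pos[OF assms(1,2)]
    by (auto simp: v_def c_def V_def)
  obtain A where A: "0 \<le> A" "\<And>k. dyadic_cube j m \<inter> tower_cube k \<noteq> {} \<Longrightarrow> norm (a k) \<le> A"
    "ennreal (A powr r * min 1 v)
      \<le> (\<integral>\<^sup>+x\<in>dyadic_cube j m. ennreal (norm (spread a x) powr r) \<partial>lebesgue)"
    using spread_cube_bound[of j m a r] unfolding v_def by blast
  have "epowr (lorentz_norm_on p q (dyadic_cube j m) (spread a)) r
      \<le> epowr (ennreal (c * A * V powr (1 / p))) r"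
    unfolding c_def V_def v_def using assms A by (intro epowr_mono lorentz_norm_on_spread_le) auto
  also have "\<dots> = ennreal ((c * A * V powr (1 / p)) powr r)"
    using pos A(1) by (intro epowr_ennreal) auto
  finally have "ennreal (v powr (r / t - r / p))
        * epowr (lorentz_norm_on p q (dyadic_cube j m) (spread a)) r
      \<le> ennreal (v powr (r / t - r / p)) * ennreal ((c * A * V powr (1 / p)) powr r)"
    by (intro mult_left_mono) auto
  also have "\<dots> = ennreal (v powr (r / t - r / p) * (c * A * V powr (1 / p)) powr r)"
    by (simp add: ennreal_mult)
  \<comment> \<open>Multiplying and dividing by \<open>min 1 v\<close> splits off exactly the
    quantity that the integral bounds.\<close>
  also have "v powr (r / t - r / p) * (c * A * V powr (1 / p)) powr r
      = (c powr r * (level_weight TYPE('n) p t j powr r / min 1 v)) * (A powr r * min 1 v)"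
  proof -
    have "v powr (r / t - r / p) = (v powr (1 / t - 1 / p)) powr r"
      by (simp add: powr_powr left_diff_distrib)
    then have "v powr (r / t - r / p) * (c * A * V powr (1 / p)) powr r
      = c powr r * level_weight TYPE('n) p t j powr r * A powr r"
      unfolding level_weight_def v_def[symmetric] V_def[symmetric]
      by (simp only: powr_mult mult_ac)
    then show ?thesis using pos(4) by simp
  qed
  also have "ennreal \<dots> = ennreal (c powr r * (level_weight TYPE('n) p t j powr r / min 1 v))
      * ennreal (A powr r * min 1 v)"
    using pos by (intro ennreal_mult) auto
  also have "\<dots> \<le> ennreal (c powr r * (level_weight TYPE('n) p t j powr r / min 1 v))
      * (\<integral>\<^sup>+x\<in>dyadic_cube j m. ennreal (norm (spread a x) powr r) \<partial>lebesgue)"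
    by (intro mult_left_mono A(3)) auto
  finally show ?thesis by (simp add: v_def c_def)
qed

section \<open>Upper bound for the norm of the image\<close>

lemma infsum_ennreal_eq_SUP:
  fixes f :: "'a \<Rightarrow> ennreal"
  shows "infsum f A = (SUP F\<in>{F. finite F \<and> F \<subseteq> A}. sum f F)"
  by (rule nonneg_infsum_complete) simp

lemma bm_norm_spread_le:
  assumes "0 < p" "0 < q" "p < t" "ennreal t < r"
  obtains C where "0 < C"
    "\<And>a :: nat \<Rightarrow> 'k::{second_countable_topology, real_normed_vector}.
      bm_norm p q t r (spread a :: real ^ 'n::finite \<Rightarrow> 'k) \<le> ennreal C * ell_norm r a"
proof (cases "r = \<infinity>")
  case True
  obtain B where B: "0 < B" "\<And>j. level_weight TYPE('n) p t j \<le> B"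
    using level_weight_bounded[OF assms(1,3), of "TYPE('n)"] by blast
  have c: "0 < lorentz_const p q" using assms by (intro lorentz_const_pos)
  show ?thesis
  proof
    fix a :: "nat \<Rightarrow> 'k"
    have "ennreal (measure lebesgue Q powr (1 / t - 1 / p)) * lorentz_norm_on p q Q (spread a)
        \<le> ennreal (lorentz_const p q * B) * ell_norm r a"
      if "Q \<in> dyadic_cubes" for Q :: "(real ^ 'n) set"
    proof -
      obtain j m where Q: "Q = dyadic_cube j m" using \<open>Q \<in> dyadic_cubes\<close> by (auto simp: dyadic_cubes_def)
      define v where "v = cube_vol TYPE('n) j"
      define V where "V = (real (nat (- j) + 1) * min 1 v) powr (1 / p)"
      show ?thesis
      \<comment> \<open>The estimate is claimed for every sequence; if its norm is infinite, so is
        the right-hand side.\<close>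
      proof (cases "ell_norm r a = \<infinity>")
        case True
        then show ?thesis using c B(1) by (simp add: ennreal_mult_top)
      next
        case False
        define A where "A = enn2real (ell_norm r a)"
        have A: "ell_norm r a = ennreal A" "0 \<le> A" using False by (auto simp: A_def less_top)
        have "ennreal (norm (a k)) \<le> ell_norm r a" for k
          using \<open>r = \<infinity>\<close> by (auto simp: ell_norm_def intro: SUP_upper)
        then have "norm (a k) \<le> A" for k using A by simp
        then have "lorentz_norm_on p q Q (spread a) \<le> ennreal (lorentz_const p q * A * V)"
          unfolding Q V_def v_def using assms A by (intro lorentz_norm_on_spread_le) auto
        then have "ennreal (measure lebesgue Q powr (1 / t - 1 / p)) * lorentz_norm_on p q Q (spread a)
            \<le> ennreal (v powr (1 / t - 1 / p)) * ennreal (lorentz_const p q * A * V)"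
          unfolding Q measure_dyadic_cube v_def by (intro mult_left_mono) auto
        also have "\<dots> = ennreal (lorentz_const p q * level_weight TYPE('n) p t j * A)"
          using A c by (simp add: level_weight_def V_def v_def ennreal_mult[symmetric] mult_ac)
        also have "\<dots> \<le> ennreal (lorentz_const p q * B * A)"
          using A c B by (intro ennreal_leI mult_right_mono mult_left_mono) auto
        finally show ?thesis using A c B(1) by (simp add: ennreal_mult)
      qed
    qed
    then show "bm_norm p q t r (spread a :: real ^ 'n \<Rightarrow> 'k)
        \<le> ennreal (lorentz_const p q * B) * ell_norm r a"
      using True by (auto simp: bm_norm_def intro!: SUP_least)
  qed (use c B(1) in simp)
next
  case False
  define s where "s = enn2real r"
  have "r = ennreal s" using False by (simp add: s_def less_top)
  then have s: "t < s" "0 < s" using assms by (simp_all add: ennreal_less_iff)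
  define w where "w j = level_weight TYPE('n) p t j powr s / min 1 (cube_vol TYPE('n) j)" for j
  obtain B \<rho> where B: "1 \<le> B" "0 \<le> \<rho>" "\<rho> < 1" "\<And>j. w j \<le> B * \<rho> ^ nat \<bar>j\<bar>"
    unfolding w_def using level_weight_decay[OF assms(1,3) s(1), of "TYPE('n)"] by blast
  define c where "c = lorentz_const p q powr s"
  have c: "0 < c" using lorentz_const_pos[OF assms(1,2)] by (simp add: c_def)
  have w: "0 \<le> w j" for j using cube_vol_pos[of "TYPE('n)" j] by (simp add: w_def)
  \<comment> \<open>The Lorentz constant to the power \<open>s\<close>, times the bound
    \<open>B * (2 / (1 - \<rho>))\<close> for the sum of \<open>w\<close> over any finite set of
    levels.\<close>
  define W where "W = c * (B * (2 / (1 - \<rho>)))"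
  have W: "0 < W" using B c by (simp add: W_def)
  show ?thesis
  proof
    fix a :: "nat \<Rightarrow> 'k"
    define I where "I Q = (\<integral>\<^sup>+x\<in>Q. ennreal (norm (spread a x) powr s) \<partial>lebesgue)"
      for Q :: "(real ^ 'n) set"
    define T where "T = (\<lambda>Q :: (real ^ 'n) set. ennreal (measure lebesgue Q powr (s / t - s / p))
           * epowr (lorentz_norm_on p q Q (spread a)) s)"
    define S where "S = (\<Sum>k. ennreal (norm (a k) powr s))"
    have "sum T F \<le> ennreal W * S" if F: "finite F" "F \<subseteq> dyadic_cubes" for F
    proof -
      have "\<forall>Q\<in>F. \<exists>j m. Q = dyadic_cube j m" using F(2) by (auto simp: dyadic_cubes_def)
      \<comment> \<open>A level is chosen for each cube, so that the finite family splits into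
        families of equal level.\<close>
      then obtain lev where lev: "\<And>Q. Q \<in> F \<Longrightarrow> \<exists>m. Q = dyadic_cube (lev Q) m"
        by metis
      have "T Q \<le> ennreal (c * w (lev Q)) * I Q" if "Q \<in> F" for Q
      proof -
        obtain m where "Q = dyadic_cube (lev Q) m" using lev[OF \<open>Q \<in> F\<close>] by blast
        then show ?thesis
          using spread_cube_term_le[OF assms(1,2) s(2), where j = "lev Q" and m = m and a = a]
          by (metis T_def I_def c_def w_def measure_dyadic_cube)
      qed
      then have "sum T F \<le> (\<Sum>Q\<in>F. ennreal (c * w (lev Q)) * I Q)" by (rule sum_mono)
      also have "\<dots> = (\<Sum>j\<in>lev ` F. \<Sum>Q\<in>{Q\<in>F. lev Q = j}. ennreal (c * w (lev Q)) * I Q)"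
        using F(1) by (rule sum.image_gen)
      also have "\<dots> = (\<Sum>j\<in>lev ` F. ennreal (c * w j) * (\<Sum>Q\<in>{Q\<in>F. lev Q = j}. I Q))"
        by (simp add: sum_distrib_left)
      also have "\<dots> \<le> (\<Sum>j\<in>lev ` F. ennreal (c * w j) * S)"
      proof (intro sum_mono mult_left_mono)
        fix j
        \<comment> \<open>Cubes of one level are disjoint, so their integrals add up to at most the
          integral over the whole space, which is \<open>S\<close>.\<close>
        show "(\<Sum>Q\<in>{Q\<in>F. lev Q = j}. I Q) \<le> S"
          unfolding I_def S_def nn_integral_spread[OF s(2), where 'n = 'n, symmetric]
          using F(1) lev by (intro sum_nn_integral_dyadic_cubes_le[where j = j]) auto
      qed simp
      also have "\<dots> = ennreal (\<Sum>j\<in>lev ` F. c * w j) * S"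
        using c w by (simp add: sum_distrib_right[symmetric] sum_ennreal)
      also have "\<dots> \<le> ennreal W * S"
      proof (intro mult_right_mono ennreal_leI)
        have "(\<Sum>j\<in>lev ` F. c * w j) \<le> c * (B * (\<Sum>j\<in>lev ` F. \<rho> ^ nat \<bar>j\<bar>))"
          unfolding sum_distrib_left using c B(4) by (intro sum_mono mult_left_mono) auto
        also have "\<dots> \<le> W"
          unfolding W_def using c B F(1) by (intro mult_left_mono sum_power_abs_int_le) auto
        finally show "(\<Sum>j\<in>lev ` F. c * w j) \<le> W" .
      qed simp
      finally show ?thesis .
    qed
    then have "infsum T dyadic_cubes \<le> ennreal W * S"
      unfolding infsum_ennreal_eq_SUP by (auto intro!: SUP_least)
    then have "epowr (infsum T dyadic_cubes) (1 / s) \<le> ennreal (W powr (1 / s)) * epowr S (1 / s)"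
      unfolding epowr_cmult[OF W, symmetric] using s by (intro epowr_mono) auto
    then show "bm_norm p q t r (spread a :: real ^ 'n \<Rightarrow> 'k) \<le> ennreal (W powr (1 / s)) * ell_norm r a"
      using False by (simp add: bm_norm_def ell_norm_def T_def S_def s_def)
  qed (use W in simp)
qed

section \<open>Lower bound from the unit cubes\<close>

lemma tower_cube_dyadic: "tower_cube k \<in> dyadic_cubes"
  by (auto simp: tower_cube_def dyadic_cubes_def)

lemma inj_tower_cube: "inj (tower_cube :: nat \<Rightarrow> (real ^ 'n) set)"
proof (rule injI)
  fix k l assume eq: "(tower_cube k :: (real ^ 'n) set) = tower_cube l"
  have "(\<chi> i. 2 ^ k) \<in> (tower_cube k :: (real ^ 'n) set)" by (simp add: mem_tower_cube)
  then show "k = l" using eq tower_cube_eq by metis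
qed

lemma measure_tower_cube: "measure lebesgue (tower_cube k :: (real ^ 'n::finite) set) = 1"
  by (simp add: measure_def emeasure_tower_cube)

text \<open>The unit cubes are distinct dyadic cubes of measure 1, so their Morrey weight is 1 and
  each contributes at least the Lorentz constant times its coefficient; the other cubes only enlarge
  the norm.\<close>

lemma bm_norm_spread_ge:
  fixes a :: "nat \<Rightarrow> 'k::real_normed_vector"
  assumes "0 < p" "0 < q" "0 < r"
  shows "ennreal (lorentz_const p q) * ell_norm r a
    \<le> bm_norm p q t r (spread a :: real ^ 'n::finite \<Rightarrow> 'k)"
proof (cases "r = \<infinity>")
  case True
  have "ennreal (lorentz_const p q) * ennreal (norm (a k))
      \<le> bm_norm p q t r (spread a :: real ^ 'n \<Rightarrow> 'k)" for k
  proof -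
    have "ennreal (lorentz_const p q) * ennreal (norm (a k))
      \<le> ennreal (measure lebesgue (tower_cube k :: (real ^ 'n) set) powr (1 / t - 1 / p))
          * lorentz_norm_on p q (tower_cube k :: (real ^ 'n) set) (spread a)"
      using lorentz_norm_on_spread_tower_cube_ge[OF assms(1,2), of a k, where 'n = 'n]
        lorentz_const_pos[OF assms(1,2)]
      by (simp add: measure_tower_cube ennreal_mult)
    also have "\<dots> \<le> bm_norm p q t r (spread a :: real ^ 'n \<Rightarrow> 'k)"
      using True tower_cube_dyadic[of k] by (auto simp: bm_norm_def intro!: SUP_upper)
    finally show ?thesis .
  qed
  then show ?thesis
    using True by (auto simp: ell_norm_def SUP_mult_left_ennreal intro!: SUP_least)
next
  case False
  define s where "s = enn2real r"
  have s: "0 < s" using assms False by (simp add: s_def enn2real_positive_iff less_top)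
  define c where "c = lorentz_const p q"
  have c: "0 < c" using lorentz_const_pos[OF assms(1,2)] by (simp add: c_def)
  define T where "T = (\<lambda>Q :: (real ^ 'n) set. ennreal (measure lebesgue Q powr (s / t - s / p))
         * epowr (lorentz_norm_on p q Q (spread a)) s)"
  define S where "S = (\<Sum>k. ennreal (norm (a k) powr s))"
  have T: "ennreal (c powr s) * ennreal (norm (a k) powr s) \<le> T (tower_cube k)" for k
  proof -
    have "epowr (ennreal (c * norm (a k))) s
        \<le> epowr (lorentz_norm_on p q (tower_cube k :: (real ^ 'n) set) (spread a)) s"
      unfolding c_def using s assms
      by (intro epowr_mono lorentz_norm_on_spread_tower_cube_ge)
    then show ?thesis
      using c by (simp add: T_def measure_tower_cube ennreal_mult' epowr_cmult epowr_ennreal)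
  qed
  have "ennreal (c powr s) * S = (\<Sum>k. ennreal (c powr s) * ennreal (norm (a k) powr s))"
    by (simp add: S_def)
  also have "\<dots> \<le> infsum T dyadic_cubes"
    unfolding suminf_eq_SUP
  proof (rule SUP_least)
    fix N
    have "(\<Sum>k<N. ennreal (c powr s) * ennreal (norm (a k) powr s)) \<le> (\<Sum>k<N. T (tower_cube k))"
      by (intro sum_mono T)
    also have "\<dots> = sum T (tower_cube ` {..<N})"
      \<comment> \<open>Distinct indices give distinct cubes, so a partial sum over indices is a sum
        over a finite family of cubes.\<close>
      using inj_on_subset[OF inj_tower_cube] by (subst sum.reindex) auto
    also have "\<dots> \<le> infsum T dyadic_cubes"
      unfolding infsum_ennreal_eq_SUP by (intro SUP_upper) (auto simp: tower_cube_dyadic)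
    finally show "(\<Sum>k<N. ennreal (c powr s) * ennreal (norm (a k) powr s)) \<le> infsum T dyadic_cubes" .
  qed
  finally have "epowr (ennreal (c powr s) * S) (1 / s) \<le> epowr (infsum T dyadic_cubes) (1 / s)"
    using s by (intro epowr_mono) auto
  then show ?thesis
    using False c s by (simp add: epowr_cmult powr_powr bm_norm_def ell_norm_def T_def S_def s_def c_def)
qed

theorem theorem2p21:
  fixes p t :: real and q r :: ennreal
  assumes "0 < q" and "0 < p" and "p < t" and "ennreal t < r"
  shows "\<exists>\<Phi> :: (nat \<Rightarrow> 'k::{real_normed_field, euclidean_space}) \<Rightarrow> (real ^ 'n::finite \<Rightarrow> 'k).
           linear_map_on (ell r) \<Phi> \<and>
           \<Phi> ` ell r \<subseteq> bm_space p q t r \<and>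
           (\<exists>C::real. C > 0 \<and>
              (\<forall>a\<in>ell r. ennreal (1 / C) * ell_norm r a \<le> bm_norm p q t r (\<Phi> a)
                       \<and> bm_norm p q t r (\<Phi> a) \<le> ennreal C * ell_norm r a))"
proof -
  obtain C where C: "0 < C" "\<And>a :: nat \<Rightarrow> 'k.
      bm_norm p q t r (spread a :: real ^ 'n \<Rightarrow> 'k) \<le> ennreal C * ell_norm r a"
    using bm_norm_spread_le[OF assms(2,1,3,4), where 'k = 'k and 'n = 'n] by blast
  define c where "c = lorentz_const p q"
  have c: "0 < c" using lorentz_const_pos assms(1,2) by (simp add: c_def)
  have "0 < r" using assms(4) by (metis gr_zeroI not_less_zero)
  \<comment> \<open>One constant for both sides: it dominates the upper constant \<open>C\<close>,
    and its reciprocal stays below the lower constant \<open>c\<close>.\<close>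
  define D where "D = max C (1 / c)"
  have D: "0 < D" "C \<le> D" "1 / D \<le> c"
    using C(1) c by (auto simp: D_def less_max_iff_disj divide_le_eq max_mult_distrib_left)
  have up: "bm_norm p q t r (spread a :: real ^ 'n \<Rightarrow> 'k) \<le> ennreal D * ell_norm r a" for a
    using D(2) by (intro order_trans[OF C(2)] mult_right_mono ennreal_leI) auto
  have low: "ennreal (1 / D) * ell_norm r a \<le> bm_norm p q t r (spread a :: real ^ 'n \<Rightarrow> 'k)" for a
    using D(3) \<open>0 < r\<close> assms
    by (intro order_trans[OF _ bm_norm_spread_ge] mult_right_mono ennreal_leI) (auto simp: c_def)
  have "linear_map_on (ell r) (spread :: (nat \<Rightarrow> 'k) \<Rightarrow> real ^ 'n \<Rightarrow> 'k)"
    by (auto simp: linear_map_on_def spread_def)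
  moreover have "(spread a :: real ^ 'n \<Rightarrow> 'k) \<in> bm_space p q t r" if "a \<in> ell r" for a :: "nat \<Rightarrow> 'k"
  proof -
    have "ennreal D * ell_norm r a < \<infinity>"
      using that by (simp add: ell_def ennreal_mult_less_top)
    then show ?thesis
      using le_less_trans[OF up[of a]] measurable_spread[of a, where 'n = 'n]
      by (simp add: bm_space_def)
  qed
  ultimately show ?thesis
    using D(1) up low by (intro exI[of _ spread]) blast
qed

end
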